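(* There exists an ideal $\mathcal{I}$ (on an infinite countable set) of Borel class $\mathbf{\Sigma}^0_6$ such that $\mathrm{rk}(\mathcal{I})>2$ and $\mathcal{I}$ does not contain an isomorphic copy of $\mathrm{Fin}^3$, i.e. $\mathrm{Fin}^3\not\sqsubseteq\mathcal{I}$.
   Context: An ideal on an infinite countable set $X$ is a collection $\mathcal{I}\subseteq\mathcal{P}(X)$ closed under subsets and finite unions, with $\mathcal{I}\neq\mathcal{P}(X)$ and containing all finite subsets of $X$ (so $X=\bigcup\mathcal{I}$). The power set $\mathcal{P}(X)$ is identified with $2^X$ (product topology, $2=\{0,1\}$ discrete) via characteristic functions; Borel classes such as $\mathbf{\Sigma}^0_\alpha$ and analyticity of subsets of $\mathcal{P}(X)$ (in particular of ideals) refer to this topology. For an ideal $\mathcal{I}$ on $X$, $\mathcal{I}^\star=\{X\setminus A: A\in\mathcal{I}\}$ is the dual filter. For $\mathcal{A},\mathcal{B},\mathcal{S}\subseteq\mathcal{P}(X)$, $\mathcal{S}$ separates $\mathcal{A}$ from $\mathcal{B}$ if $\mathcal{A}\subseteq\mathcal{S}$ and $\mathcal{S}\cap\mathcal{B}=\emptyset$. The (Borel separation) rank of an analytic ideal $\mathcal{I}$ is $$\mathrm{rk}(\mathcal{I})=\min\{\alpha<\omega_1:\text{ there is }\mathcal{S}\in\mathbf{\Sigma}^0_{1+\alpha}\text{ separating }\mathcal{I}\text{ from }\mathcal{I}^\star\}.$$ Thus $\mathrm{rk}(\mathcal{I})>2$ means that no $\mathbf{\Sigma}^0_3$ set separates $\mathcal{I}$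 from $\mathcal{I}^\star$. For ideals $\mathcal{I},\mathcal{J}$, one says $\mathcal{J}$ contains an isomorphic copy of $\mathcal{I}$, written $\mathcal{I}\sqsubseteq\mathcal{J}$, if there is a bijection $f:\bigcup\mathcal{J}\to\bigcup\mathcal{I}$ such that for every $A\subseteq\bigcup\mathcal{I}$, $A\in\mathcal{I}$ implies $f^{-1}[A]\in\mathcal{J}$. $\mathrm{Fin}^1=\mathrm{Fin}=[\omega]^{<\omega}$ is the ideal of finite subsets of $\omega$, and $\mathrm{Fin}^{n+1}=\mathrm{Fin}\otimes\mathrm{Fin}^n$ (an ideal on $\omega^{n+1}$), where $\mathcal{I}\otimes\mathcal{J}=\{A\subseteq\bigcup\mathcal{I}\times\bigcup\mathcal{J}:\{x\in\bigcup\mathcal{I}:A_{(x)}\notin\mathcal{J}\}\in\mathcal{I}\}$ and $A_{(x)}=\{y:(x,y)\in A\}$. *)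

theory Defs
  imports "HOL-Analysis.Analysis"
begin

section \<open>Countable ordinals\<close>

text \<open>The elements of \<open>omega1\<close> are the ordinals below the first uncountable ordinal: it is a
  well-order of type \<open>cardSuc natLeq\<close> (see \<open>uncountable_omega1\<close> and \<open>countable_below_omega1\<close>).\<close>

typedef omega1 = "Field (cardSuc natLeq)"
proof -
  have "infinite (Field (cardSuc natLeq))"
    using cardSuc_finite[OF natLeq_Card_order] Field_natLeq infinite_UNIV_nat by auto
  then show ?thesis by (metis all_not_in_conv finite.emptyI)
qed

lemma cardSuc_natLeq_wo_rel: "wo_rel (cardSuc natLeq)"
  using cardSuc_Card_order[OF natLeq_Card_order]
  unfolding wo_rel_def card_order_on_def by blast

instantiation omega1 :: wellorder
begin

definition less_eq_omega1 :: "omega1 \<Rightarrow> omega1 \<Rightarrow> bool" where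
  "less_eq_omega1 a b \<longleftrightarrow> (Rep_omega1 a, Rep_omega1 b) \<in> cardSuc natLeq"

definition less_omega1 :: "omega1 \<Rightarrow> omega1 \<Rightarrow> bool" where
  "less_omega1 a b \<longleftrightarrow> a \<le> b \<and> a \<noteq> b"

instance
proof
  fix x y z :: omega1
  note W = cardSuc_natLeq_wo_rel
  show refl: "x \<le> x"
    unfolding less_eq_omega1_def by (rule refl_onD[OF wo_rel.REFL[OF W] Rep_omega1])
  show "x \<le> y \<Longrightarrow> y \<le> z \<Longrightarrow> x \<le> z"
    unfolding less_eq_omega1_def by (rule transD[OF wo_rel.TRANS[OF W]])
  show anti: "x \<le> y \<Longrightarrow> y \<le> x \<Longrightarrow> x = y"
    unfolding less_eq_omega1_def Rep_omega1_inject[symmetric]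
    by (rule antisymD[OF wo_rel.ANTISYM[OF W]])
  show "(x < y) = (x \<le> y \<and> \<not> y \<le> x)"
    unfolding less_omega1_def using anti refl by metis
  show "x \<le> y \<or> y \<le> x"
    unfolding less_eq_omega1_def using wo_rel.TOTALS[OF W] Rep_omega1[of x] Rep_omega1[of y] by simp
next
  fix P :: "omega1 \<Rightarrow> bool" and a
  assume step: "\<And>x. (\<And>y. y < x \<Longrightarrow> P y) \<Longrightarrow> P x"
  have wf: "wf (inv_image (cardSuc natLeq - Id) Rep_omega1)"
    by (rule wf_inv_image[OF wo_rel.WF[OF cardSuc_natLeq_wo_rel]])
  show "P a"
  proof (induction a rule: wf_induct_rule[OF wf])
    case (1 x)
    show ?case
      by (rule step, rule 1)
        (auto simp: less_omega1_def less_eq_omega1_def Rep_omega1_inject)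
  qed
qed

end

lemma uncountable_omega1: "uncountable (UNIV :: omega1 set)"
proof
  include cardinal_syntax
  assume "countable (UNIV :: omega1 set)"
  then have "countable (Field (cardSuc natLeq))"
    using countable_image[of UNIV Rep_omega1] type_definition.Rep_range[OF type_definition_omega1]
    by simp
  then obtain f :: "nat set \<Rightarrow> nat" where "inj_on f (Field (cardSuc natLeq))"
    unfolding countable_def by blast
  then have "|Field (cardSuc natLeq)| \<le>o |UNIV :: nat set|"
    using card_of_ordLeq by blast
  moreover have "|Field (cardSuc natLeq)| =o cardSuc natLeq"
    by (rule card_of_Field_ordIso[OF cardSuc_Card_order[OF natLeq_Card_order]])
  moreover have "|UNIV :: nat set| =o natLeq" by (rule card_of_nat)
  ultimately have "cardSuc natLeq \<le>o natLeq"
    using ordIso_ordLeq_trans ordIso_symmetric ordLeq_ordIso_trans by blast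
  then show False
    using cardSuc_greater[OF natLeq_Card_order] not_ordLess_ordLeq by blast
qed

lemma countable_below_omega1: "countable {b. b < (a :: omega1)}"
proof -
  include cardinal_syntax
  have "|underS (cardSuc natLeq) (Rep_omega1 a)| <o cardSuc natLeq"
    by (rule card_of_underS[OF cardSuc_Card_order[OF natLeq_Card_order] Rep_omega1])
  then have "|underS (cardSuc natLeq) (Rep_omega1 a)| \<le>o natLeq"
    by (subst (asm) cardSuc_ordLeq_ordLess[OF natLeq_Card_order card_of_Card_order])
  then have "|underS (cardSuc natLeq) (Rep_omega1 a)| \<le>o |UNIV :: nat set|"
    using card_of_nat ordIso_symmetric ordLeq_ordIso_trans by blast
  then have "countable (underS (cardSuc natLeq) (Rep_omega1 a))"
    unfolding card_of_ordLeq[symmetric] countable_def by blast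
  moreover have "Rep_omega1 ` {b. b < a} \<subseteq> underS (cardSuc natLeq) (Rep_omega1 a)"
    by (auto simp: underS_def less_omega1_def less_eq_omega1_def Rep_omega1_inject)
  ultimately have "countable (Rep_omega1 ` {b. b < a})"
    by (rule countable_subset[rotated])
  then show ?thesis
    by (rule countable_image_inj_on) (simp add: inj_on_def Rep_omega1_inject)
qed

text \<open>The finite ordinals, as elements of \<open>omega1\<close>.\<close>

primrec fin_ord :: "nat \<Rightarrow> omega1" where
  "fin_ord 0 = (LEAST a. True)"
| "fin_ord (Suc n) = (LEAST a. fin_ord n < a)"

lemma omega1_no_max: "\<exists>b. (a :: omega1) < b"
proof (rule ccontr)
  assume "\<not> (\<exists>b. a < b)"
  then have "(UNIV :: omega1 set) = insert a {b. b < a}"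
    by (auto simp: not_less order.order_iff_strict)
  then show False
    using uncountable_omega1 countable_below_omega1[of a] by (metis countable_insert)
qed

lemma below_fin_ord: "{b. b < fin_ord n} = fin_ord ` {..<n}"
proof (induction n)
  case 0
  show ?case by (auto dest: not_less_Least)
next
  case (Suc n)
  have "fin_ord n < fin_ord (Suc n)"
    using omega1_no_max[of "fin_ord n"] by (auto intro: LeastI)
  moreover have "b \<le> fin_ord n" if "b < fin_ord (Suc n)" for b
    using that not_less_Least[of b "\<lambda>a. fin_ord n < a"] by auto
  ultimately have "{b. b < fin_ord (Suc n)} = insert (fin_ord n) {b. b < fin_ord n}"
    by (auto simp: order.order_iff_strict simp del: fin_ord.simps)
  then show ?case using Suc by (simp add: lessThan_Suc)
qed


section \<open>Borel classes\<close>

text \<open>\<open>Sigma0_1plus T \<alpha> S\<close> says that \<open>S\<close> is of additive Borel class \<open>1 + \<alpha>\<close> in the space \<open>T\<close>.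
  The shift by one avoids a junk class at index 0 and matches the definition of the rank below.  In
  particular \<open>Sigma0_1plus T (fin_ord n)\<close> is the class \<open>\<Sigma>\<^sup>0\<close> of level \<open>n + 1\<close>.\<close>

inductive Sigma0_1plus :: "'a topology \<Rightarrow> omega1 \<Rightarrow> 'a set \<Rightarrow> bool" for T where
  "openin T U \<Longrightarrow> Sigma0_1plus T (fin_ord 0) U"
| "(\<And>n :: nat. \<beta> n < \<alpha>) \<Longrightarrow> (\<And>n. Sigma0_1plus T (\<beta> n) (B n))
    \<Longrightarrow> Sigma0_1plus T \<alpha> (\<Union>n. topspace T - B n)"


section \<open>Ideals and their separation rank\<close>

text \<open>The topology on the power set of \<open>X\<close> obtained from the product space \<open>2\<^sup>X\<close> through
  characteristic functions.\<close>

definition powerset_topology :: "'a set \<Rightarrow> 'a set topology" where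
  "powerset_topology X =
     pullback_topology (Pow X) (\<lambda>A. \<lambda>x\<in>X. x \<in> A)
       (product_topology (\<lambda>_. discrete_topology (UNIV :: bool set)) X)"

definition ideal_on :: "'a set \<Rightarrow> 'a set set \<Rightarrow> bool" where
  "ideal_on X I \<longleftrightarrow>
     infinite X \<and> countable X \<and>
     I \<subseteq> Pow X \<and> I \<noteq> Pow X \<and>
     (\<forall>A\<in>I. \<forall>B. B \<subseteq> A \<longrightarrow> B \<in> I) \<and>
     (\<forall>A\<in>I. \<forall>B\<in>I. A \<union> B \<in> I) \<and>
     (\<forall>A. A \<subseteq> X \<and> finite A \<longrightarrow> A \<in> I)"

definition dual_filter :: "'a set \<Rightarrow> 'a set set \<Rightarrow> 'a set set" where
  "dual_filter X I = {X - A | A. A \<in> I}"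

definition separates :: "'a set \<Rightarrow> 'a set \<Rightarrow> 'a set \<Rightarrow> bool" where
  "separates S A B \<longleftrightarrow> A \<subseteq> S \<and> S \<inter> B = {}"

text \<open>The minimum exists for every analytic ideal; the value is meaningless if no Borel set
  separates \<open>I\<close> from its dual filter.\<close>

definition ideal_rank :: "'a set \<Rightarrow> 'a set set \<Rightarrow> omega1" where
  "ideal_rank X I =
     (LEAST \<alpha>. \<exists>S. Sigma0_1plus (powerset_topology X) \<alpha> S \<and> separates S I (dual_filter X I))"


section \<open>Isomorphic copies and Fubini products\<close>

text \<open>As an ideal covers its underlying set, the latter is recovered as \<open>\<Union>I\<close>.\<close>

definition contains_copy_of :: "'b set set \<Rightarrow> 'a set set \<Rightarrow> bool" where
  "contains_copy_of J I \<longleftrightarrow>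
     (\<exists>f. bij_betw f (\<Union>J) (\<Union>I) \<and> (\<forall>A. A \<subseteq> \<Union>I \<longrightarrow> A \<in> I \<longrightarrow> f -` A \<inter> \<Union>J \<in> J))"

definition ideal_prod :: "'a set set \<Rightarrow> 'b set set \<Rightarrow> ('a \<times> 'b) set set" (infixr "\<otimes>\<^sub>I" 70) where
  "I \<otimes>\<^sub>I J = {A. A \<subseteq> \<Union>I \<times> \<Union>J \<and> {x \<in> \<Union>I. {y. (x, y) \<in> A} \<notin> J} \<in> I}"

definition Fin :: "nat set set" where
  "Fin = {A. finite A}"

definition Fin3 :: "(nat \<times> nat \<times> nat) set set" where
  "Fin3 = Fin \<otimes>\<^sub>I (Fin \<otimes>\<^sub>I Fin)"

end

theory Submission
  imports Defs "HOL-Library.Sublist"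
begin

text \<open>
  The ideal lives on a countable set whose points code finite sets of nodes of the tree of finite
  sequences of naturals. It contains every family of finite sets that avoid a fixed infinite
  branch, and every family that accumulates at a node \<open>s\<close>, in the sense that for each \<open>k\<close> almost all
  of its members contain \<open>s\<close> or a node that leaves \<open>s\<close> through a child of index at least \<open>k\<close>.

  Given a \<open>\<Sigma>\<^sup>0\<^sub>3\<close> set \<open>\<Union>n. G n\<close>, one walks up the tree. At a node \<open>s\<close> one passes to a child of larger
  and larger index, each time trying to force the generic family out of the \<open>G\<^sub>\<delta>\<close> set \<open>G n\<close>. If
  this never succeeds, the attempts build a member of the dual filter in \<open>G n\<close>, whose complement
  accumulates at \<open>s\<close>. Otherwise the walk follows a branch, and the family of sets avoiding it is a
  member of the ideal outside all \<open>G n\<close>. So no \<open>\<Sigma>\<^sup>0\<^sub>3\<close> set separates.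

  A copy of \<open>Fin\<^sup>3\<close> would provide one uniform witness against all functions \<open>z\<close> bounding its middle
  coordinate. Letting \<open>z\<close> grow fast compared with the witnesses for the initial segments of the
  first coordinate, one finds infinitely many codes of one finite set of nodes that escape both.

  The ideal generated by the two kinds of families need not be Borel, since membership would ask for
  a branch. The definition of \<open>small\<close> only asks for finite sets of nodes, arbitrarily high in the
  tree, that stay away from the fans around finitely many nodes, which costs six quantifiers.
\<close>

section \<open>The ideal\<close>

text \<open>Each finite set of nodes has infinitely many codes \<open>e\<close>.\<close>

definition nodes :: "nat \<Rightarrow> nat list set" where
  "nodes e = set (from_nat (fst (prod_decode e)))"

text \<open>A basic neighbourhood of \<open>Z\<close> in the topology on the tree in which the
  subtrees above the children of a node converge to that node.\<close>

definition nbhd :: "nat list set \<Rightarrow> nat \<Rightarrow> nat list set" where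
  "nbhd Z k = Z \<union> {s @ j # t | s j t. s \<in> Z \<and> k \<le> j}"

definition test :: "nat list set \<Rightarrow> nat \<Rightarrow> nat list set \<Rightarrow> nat set" where
  "test Z k W = {e. W \<subseteq> nodes e \<and> nodes e \<inter> nbhd Z k = {}}"

text \<open>The same \<open>k\<close> bounds the length of the members of \<open>W\<close> from below and fixes the neighbourhood in
  the last conjunct; two separate parameters would raise the Borel class.\<close>

definition small :: "nat list set \<Rightarrow> nat set \<Rightarrow> bool" where
  "small Z A \<longleftrightarrow> (\<exists>k0. \<forall>k\<ge>k0. \<exists>W. finite W \<and> (\<forall>w\<in>W. k \<le> length w) \<and>
     W \<inter> nbhd Z k0 = {} \<and> finite (A \<inter> test Z k W))"

text \<open>A larger \<open>Z\<close> shrinks \<open>test Z k W\<close> but leaves less room for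
  \<open>W\<close>, so \<open>small\<close> is not evidently monotone in \<open>Z\<close>.
  Quantifying over all finite supersets makes this family grow with \<open>Z\<close>; hence the
  union in \<open>tree_ideal\<close> is directed.\<close>

definition tree_ideal_from :: "nat list set \<Rightarrow> nat set set" where
  "tree_ideal_from Z = {A. \<forall>Z'. finite Z' \<longrightarrow> Z \<subseteq> Z' \<longrightarrow> small Z' A}"

definition tree_ideal :: "nat set set" where
  "tree_ideal = (\<Union>Z\<in>{Z. finite Z}. tree_ideal_from Z)"

section \<open>Codes, neighbourhoods and closure properties of smallness\<close>

lemma finite_nodes: "finite (nodes e)"
  by (simp add: nodes_def)

text \<open>The second component of a code is free. This contradicts the finiteness of test sets,
  first for \<open>UNIV\<close> and later for a copy of \<open>Fin3\<close>.\<close>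

lemma infinite_nodes_eq:
  assumes "finite F"
  shows "infinite {e. nodes e = F}"
proof -
  obtain xs where xs: "set xs = F"
    using finite_list[OF assms] by blast
  have "range (\<lambda>n. prod_encode (to_nat xs, n)) \<subseteq> {e. nodes e = F}"
    by (auto simp: nodes_def xs)
  moreover have "inj (\<lambda>n. prod_encode (to_nat xs, n))"
    by (auto simp: inj_on_def)
  ultimately show ?thesis
    by (metis finite_imageD infinite_UNIV_nat finite_subset)
qed

lemma nbhd_mono: "Z \<subseteq> Z' \<Longrightarrow> k' \<le> k \<Longrightarrow> nbhd Z k \<subseteq> nbhd Z' k'"
  unfolding nbhd_def by fastforce

lemma test_antimono: "W \<subseteq> W' \<Longrightarrow> test Z k W' \<subseteq> test Z k W"
  by (auto simp: test_def)

text \<open>A node outside \<open>Z\<close> enters the neighbourhood only through one of its entries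
  that is at least \<open>k\<close>, and the nodes in \<open>F\<close> have finitely many entries
  altogether.\<close>

lemma finite_avoids_nbhd:
  assumes "finite F" "F \<inter> Z = {}"
  obtains k0 where "\<And>k. k0 \<le> k \<Longrightarrow> F \<inter> nbhd Z k = {}"
proof -
  define E where "E = (\<Union>w\<in>F. set w)"
  have "finite E" unfolding E_def using assms by auto
  then obtain k0 where k0: "\<And>j. j \<in> E \<Longrightarrow> j < k0"
    by (metis finite_nat_set_iff_bounded)
  have "F \<inter> nbhd Z k0 = {}"
  proof (rule ccontr)
    assume "F \<inter> nbhd Z k0 \<noteq> {}"
    then obtain s j t where "s @ j # t \<in> F" "k0 \<le> j"
      using assms(2) by (auto simp: nbhd_def)
    then have "j \<in> E" unfolding E_def by force
    then show False using k0 \<open>k0 \<le> j\<close> by fastforce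
  qed
  then show ?thesis
    using that[of k0] nbhd_mono[OF order_refl] by blast
qed

lemma smallD:
  assumes "small Z A"
  obtains k0 where "\<And>k. k0 \<le> k \<Longrightarrow> \<exists>W. finite W \<and> (\<forall>w\<in>W. k \<le> length w) \<and>
     W \<inter> nbhd Z k0 = {} \<and> finite (A \<inter> test Z k W)"
  using assms unfolding small_def by blast

lemma small_subset: "small Z A \<Longrightarrow> B \<subseteq> A \<Longrightarrow> small Z B"
  unfolding small_def by (meson Int_mono finite_subset order_refl)

text \<open>The union of the two witnesses works, as \<open>test\<close> is antimonotone in
  \<open>W\<close> and the larger threshold gives the smaller neighbourhood.\<close>

lemma small_Un:
  assumes "small Z A" "small Z B"
  shows "small Z (A \<union> B)"
proof -
  obtain k1 where k1: "\<And>k. k1 \<le> k \<Longrightarrow> \<exists>W. finite W \<and> (\<forall>w\<in>W. k \<le> length w) \<and>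
     W \<inter> nbhd Z k1 = {} \<and> finite (A \<inter> test Z k W)"
    using smallD[OF assms(1)] by blast
  obtain k2 where k2: "\<And>k. k2 \<le> k \<Longrightarrow> \<exists>W. finite W \<and> (\<forall>w\<in>W. k \<le> length w) \<and>
     W \<inter> nbhd Z k2 = {} \<and> finite (B \<inter> test Z k W)"
    using smallD[OF assms(2)] by blast
  show ?thesis
    unfolding small_def
  proof (intro exI[of _ "max k1 k2"] allI impI)
    fix k assume k: "max k1 k2 \<le> k"
    obtain V where V: "finite V" "\<forall>w\<in>V. k \<le> length w" "V \<inter> nbhd Z k1 = {}" "finite (A \<inter> test Z k V)"
      using k1[of k] k by auto
    obtain W where W: "finite W" "\<forall>w\<in>W. k \<le> length w" "W \<inter> nbhd Z k2 = {}" "finite (B \<inter> test Z k W)"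
      using k2[of k] k by auto
    have "(A \<union> B) \<inter> test Z k (V \<union> W) \<subseteq> (A \<inter> test Z k V) \<union> (B \<inter> test Z k W)"
      using test_antimono[of V "V \<union> W"] test_antimono[of W "V \<union> W"] by blast
    then have "finite ((A \<union> B) \<inter> test Z k (V \<union> W))"
      using V(4) W(4) by (meson finite_UnI finite_subset)
    moreover have "nbhd Z (max k1 k2) \<subseteq> nbhd Z k1 \<inter> nbhd Z k2"
      by (simp add: nbhd_mono)
    ultimately show "\<exists>W. finite W \<and> (\<forall>w\<in>W. k \<le> length w) \<and> W \<inter> nbhd Z (max k1 k2) = {} \<and>
        finite ((A \<union> B) \<inter> test Z k W)"
      using V W by (intro exI[of _ "V \<union> W"]) blast
  qed
qed

text \<open>A witness \<open>W\<close> at the threshold itself misses the neighbourhood, so every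
  code of \<open>W\<close> passes the test.\<close>

lemma not_small_UNIV:
  assumes "finite Z"
  shows "\<not> small Z UNIV"
proof
  assume "small Z UNIV"
  then obtain k W where W: "finite W" "W \<inter> nbhd Z k = {}" "finite (test Z k W)"
    unfolding small_def by (metis Int_UNIV_left order_refl)
  then have "{e. nodes e = W} \<subseteq> test Z k W"
    by (auto simp: test_def)
  then show False
    using W infinite_nodes_eq finite_subset by blast
qed

section \<open>Two sources of members: sparse families and families avoiding a branch\<close>

lemma small_if_sparse:
  assumes "\<And>k. finite {e\<in>A. nodes e \<inter> nbhd Z k = {}}"
  shows "small Z A"
proof -
  have "finite (A \<inter> test Z k {})" for k
    using assms[of k] by (rule finite_subset[rotated]) (auto simp: test_def)
  then show ?thesis
    unfolding small_def by (intro exI[of _ 0] allI impI exI[of _ "{}"]) simp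
qed

lemma tree_ideal_from_subset: "A \<in> tree_ideal_from Z \<Longrightarrow> B \<subseteq> A \<Longrightarrow> B \<in> tree_ideal_from Z"
  unfolding tree_ideal_from_def using small_subset by blast

lemma tree_ideal_iff: "A \<in> tree_ideal \<longleftrightarrow> (\<exists>Z. finite Z \<and> A \<in> tree_ideal_from Z)"
  by (auto simp: tree_ideal_def)

lemma sparse_in_tree_ideal:
  assumes "finite Z" "\<And>k. finite {e\<in>A. nodes e \<inter> nbhd Z k = {}}"
  shows "A \<in> tree_ideal"
proof -
  have "small Z' A" if "Z \<subseteq> Z'" for Z'
  proof (rule small_if_sparse)
    fix k
    show "finite {e\<in>A. nodes e \<inter> nbhd Z' k = {}}"
      using assms(2)[of k] by (rule finite_subset[rotated]) (use nbhd_mono[OF that] in blast)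
  qed
  then show ?thesis
    using assms(1) by (auto simp: tree_ideal_iff tree_ideal_from_def)
qed

text \<open>The witness is the single branch node of length \<open>k\<close>, which no member of
  \<open>A\<close> contains. If it left \<open>s\<close> in \<open>Z\<close> through child
  \<open>j\<close>, then \<open>j\<close> would be \<open>x (length s)\<close>, which is below the
  threshold \<open>b\<close>.\<close>

lemma branch_avoiding_in_tree_ideal:
  fixes x :: "nat \<Rightarrow> nat"
  assumes "\<And>e n. e \<in> A \<Longrightarrow> map x [0..<n] \<notin> nodes e"
  shows "A \<in> tree_ideal"
proof -
  have "small Z A" if fin: "finite Z" for Z
  proof -
    obtain b where b: "\<And>s. s \<in> Z \<Longrightarrow> x (length s) < b \<and> length s < b"
    proof -
      have "finite ((\<lambda>s. x (length s)) ` Z \<union> length ` Z)" using fin by simp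
      then obtain b where "\<forall>n\<in>(\<lambda>s. x (length s)) ` Z \<union> length ` Z. n < b"
        by (metis finite_nat_set_iff_bounded)
      then show ?thesis using that by blast
    qed
    show ?thesis
      unfolding small_def
    proof (intro exI[of _ b] allI impI)
      fix k assume "b \<le> k"
      define w where "w = map x [0..<k]"
      have "w \<notin> Z" using b[of w] \<open>b \<le> k\<close> by (auto simp: w_def)
      moreover have "w \<noteq> s @ j # t" if "s \<in> Z" "b \<le> j" for s j t
      proof
        assume eq: "w = s @ j # t"
        then have "length s < k" by (metis w_def length_map length_upt diff_zero length_append
              length_Cons add_Suc_right less_add_Suc1)
        then have "w ! length s = x (length s)" by (simp add: w_def)
        then show False using eq b[OF that(1)] that(2) by simp
      qed
      ultimately have "w \<notin> nbhd Z b" unfolding nbhd_def by blast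
      moreover have "A \<inter> test Z k {w} = {}"
        using assms by (auto simp: test_def w_def)
      ultimately show "\<exists>W. finite W \<and> (\<forall>w\<in>W. k \<le> length w) \<and> W \<inter> nbhd Z b = {} \<and>
          finite (A \<inter> test Z k W)"
        by (intro exI[of _ "{w}"]) (simp add: w_def)
    qed
  qed
  then show ?thesis
    by (auto simp: tree_ideal_iff tree_ideal_from_def intro: exI[of _ "{}"])
qed

lemma ideal_on_tree_ideal: "ideal_on UNIV tree_ideal"
  unfolding ideal_on_def
proof (intro conjI ballI allI impI)
  show "tree_ideal \<noteq> Pow UNIV"
  proof
    assume "tree_ideal = Pow UNIV"
    then obtain Z where "finite Z" "UNIV \<in> tree_ideal_from Z"
      using tree_ideal_iff by auto
    then show False using not_small_UNIV unfolding tree_ideal_from_def by blast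
  qed
next
  fix A B assume "A \<in> tree_ideal" "B \<subseteq> A"
  then show "B \<in> tree_ideal"
    using tree_ideal_iff tree_ideal_from_subset by metis
next
  fix A B assume "A \<in> tree_ideal" "B \<in> tree_ideal"
  then obtain Y Z where "finite Y" "A \<in> tree_ideal_from Y" "finite Z" "B \<in> tree_ideal_from Z"
    by (auto simp: tree_ideal_iff)
  then have "finite (Y \<union> Z)" "A \<union> B \<in> tree_ideal_from (Y \<union> Z)"
    by (auto simp: tree_ideal_from_def small_Un)
  then show "A \<union> B \<in> tree_ideal"
    unfolding tree_ideal_iff by blast
next
  fix A :: "nat set" assume "A \<subseteq> UNIV \<and> finite A"
  then show "A \<in> tree_ideal"
    by (intro sparse_in_tree_ideal[of "{}"]) auto
qed auto


section \<open>Borel complexity\<close>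

definition determined :: "nat set set \<Rightarrow> bool" where
  "determined S \<longleftrightarrow> (\<forall>A\<in>S. \<exists>n. \<forall>B. B \<inter> {..<n} = A \<inter> {..<n} \<longrightarrow> B \<in> S)"

lemma topspace_powerset_topology [simp]: "topspace (powerset_topology X) = Pow X"
  by (auto simp: powerset_topology_def topspace_pullback_topology topspace_product_topology)

lemma openin_powerset_topology_nat:
  "openin (powerset_topology (UNIV :: nat set)) S \<longleftrightarrow> determined S"
proof
  assume "openin (powerset_topology (UNIV :: nat set)) S"
  then obtain V where V: "openin (product_topology (\<lambda>_. discrete_topology (UNIV :: bool set)) UNIV) V"
    and S: "S = (\<lambda>A x. x \<in> A) -` V"
    by (auto simp: powerset_topology_def openin_pullback_topology restrict_def)
  show "determined S"
    unfolding determined_def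
  proof
    fix A assume "A \<in> S"
    then have "(\<lambda>x. x \<in> A) \<in> V" by (simp add: S)
    then obtain U where U: "finite {i. U i \<noteq> (UNIV :: bool set)}" "(\<lambda>x. x \<in> A) \<in> (\<Pi>\<^sub>E i\<in>UNIV. U i)"
      "(\<Pi>\<^sub>E i\<in>UNIV. U i) \<subseteq> V"
      using V unfolding openin_product_topology_alt by auto
    obtain n where "{i. U i \<noteq> UNIV} \<subseteq> {..<n}"
      using U(1) finite_nat_iff_bounded by blast
    then have n: "\<And>i. U i \<noteq> UNIV \<Longrightarrow> i < n" by blast
    have "B \<in> S" if B: "B \<inter> {..<n} = A \<inter> {..<n}" for B
    proof -
      have "(i \<in> B) \<in> U i" for i
      proof (cases "U i = UNIV")
        case False
        then have "i \<in> B \<longleftrightarrow> i \<in> A" using n[OF False] B by blast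
        then show ?thesis using U(2) by (auto simp: PiE_iff)
      qed simp
      then show ?thesis using U(3) by (auto simp: S PiE_iff)
    qed
    then show "\<exists>n. \<forall>B. B \<inter> {..<n} = A \<inter> {..<n} \<longrightarrow> B \<in> S" by blast
  qed
next
  assume det: "determined S"
  define V where "V = (\<lambda>A x. x \<in> A) ` S"
  have "openin (product_topology (\<lambda>_. discrete_topology (UNIV :: bool set)) UNIV) V"
    unfolding openin_product_topology_alt
  proof (intro ballI)
    fix p assume "p \<in> V"
    then obtain A where A: "A \<in> S" "p = (\<lambda>x. x \<in> A)" by (auto simp: V_def)
    then obtain n where n: "\<And>B. B \<inter> {..<n} = A \<inter> {..<n} \<Longrightarrow> B \<in> S"
      using det unfolding determined_def by blast
    define U where "U i = (if i < n then {p i} else (UNIV :: bool set))" for i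
    have "{i. U i \<noteq> UNIV} \<subseteq> {..<n}" by (auto simp: U_def)
    then have "finite {i. U i \<noteq> UNIV}" using finite_subset by blast
    moreover have "p \<in> (\<Pi>\<^sub>E i\<in>UNIV. U i)" by (simp add: U_def PiE_iff)
    moreover have "(\<Pi>\<^sub>E i\<in>UNIV. U i) \<subseteq> V"
    proof
      fix q assume "q \<in> (\<Pi>\<^sub>E i\<in>UNIV. U i)"
      then have q: "q i \<in> U i" for i by (simp add: PiE_iff)
      have "q i = p i" if "i < n" for i
        using q[of i] that by (simp add: U_def)
      then have "{i. q i} \<inter> {..<n} = A \<inter> {..<n}" by (auto simp: A)
      then have "{i. q i} \<in> S" by (rule n)
      then show "q \<in> V" unfolding V_def by (intro image_eqI[of _ _ "{i. q i}"]) auto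
    qed
    ultimately show "\<exists>U. finite {i\<in>UNIV. U i \<noteq> topspace (discrete_topology (UNIV :: bool set))} \<and>
        (\<forall>i\<in>UNIV. openin (discrete_topology UNIV) (U i)) \<and> p \<in> Pi\<^sub>E UNIV U \<and> Pi\<^sub>E UNIV U \<subseteq> V"
      by (intro exI[of _ U]) simp
  qed
  moreover have "S = (\<lambda>A x. x \<in> A) -` V"
    unfolding V_def by (auto simp: fun_eq_iff set_eq_iff[symmetric])
  ultimately show "openin (powerset_topology (UNIV :: nat set)) S"
    by (auto simp: powerset_topology_def openin_pullback_topology restrict_def)
qed

abbreviation Sig :: "nat \<Rightarrow> nat set set \<Rightarrow> bool" where
  "Sig n \<equiv> Sigma0_1plus (powerset_topology UNIV) (fin_ord n)"

lemma fin_ord_less_Suc: "fin_ord n < fin_ord (Suc n)"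
  using below_fin_ord[of "Suc n"] by blast

text \<open>The inductive clause takes unions of complements. Used alternately with
  \<open>Sig_not_All\<close>, this raises the class by one per quantifier.\<close>

lemma Sig_Ex:
  fixes P :: "'i::countable \<Rightarrow> nat set \<Rightarrow> bool"
  assumes "\<And>i. Sig n {A. \<not> P i A}"
  shows "Sig (Suc n) {A. \<exists>i. P i A}"
proof -
  have "Sig (Suc n) (\<Union>c. topspace (powerset_topology UNIV) - {A. \<not> P (from_nat c) A})"
    by (rule Sigma0_1plus.intros(2)) (use assms fin_ord_less_Suc in blast)+
  moreover have "(\<Union>c. topspace (powerset_topology UNIV) - {A. \<not> P (from_nat c) A}) = {A. \<exists>i. P i A}"
    by (auto, metis from_nat_to_nat)
  ultimately show ?thesis by simp
qed

lemma Sig_not_All: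
  fixes P :: "'i::countable \<Rightarrow> nat set \<Rightarrow> bool"
  assumes "\<And>i. Sig n {A. P i A}"
  shows "Sig (Suc n) {A. \<not> (\<forall>i. P i A)}"
  using Sig_Ex[of n "\<lambda>i A. \<not> P i A"] assms by simp

lemma ex_finite_iff_list: "(\<exists>Z. finite Z \<and> P Z) \<longleftrightarrow> (\<exists>zs. P (set zs))"
  by (metis List.finite_set finite_list)

lemma all_finite_supset_iff_list:
  "(\<forall>Z'. finite Z' \<longrightarrow> set zs \<subseteq> Z' \<longrightarrow> P Z') \<longleftrightarrow> (\<forall>ys. P (set (zs @ ys)))"
  by (metis List.finite_set finite_list set_append subset_Un_eq sup_ge1)

text \<open>All quantifiers now range over countable types. The witness and the bound that expresses
  finiteness form one pair \<open>p\<close>, so they cost a single quantifier, and writing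
  \<open>k0 + k\<close> absorbs the restriction \<open>k \<ge> k0\<close>.\<close>

lemma small_iff_list:
  "small Z A \<longleftrightarrow> (\<exists>k0. \<forall>k. \<exists>p. (\<forall>w\<in>set (fst p). k0 + k \<le> length w) \<and>
     set (fst p) \<inter> nbhd Z k0 = {} \<and> (\<forall>e\<ge>snd p. e \<notin> A \<inter> test Z (k0 + k) (set (fst p))))"
proof -
  have fin: "finite B \<longleftrightarrow> (\<exists>n. \<forall>e\<ge>n. e \<notin> B)" for B :: "nat set"
    by (metis finite_nat_set_iff_bounded not_le)
  have ge: "(\<forall>k\<ge>k0. P k) \<longleftrightarrow> (\<forall>k. P (k0 + k))" for k0 :: nat and P
    by (metis le_add1 le_iff_add)
  show ?thesis
    unfolding small_def ge fin ex_finite_iff_list by (simp add: split_paired_Ex)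
qed

text \<open>The matrix \<open>C\<close> is closed, so its negation has index 0, and the prefix of
  five alternating quantifiers leads to index 5, that is
  \<open>\<Sigma>\<^sup>0\<^sub>6\<close>.\<close>

lemma Sig_tree_ideal: "Sig 5 tree_ideal"
proof -
  define C where "C Z k0 k p A \<longleftrightarrow> (\<forall>w\<in>set (fst p). k0 + k \<le> length w) \<and>
     set (fst p) \<inter> nbhd Z k0 = {} \<and> (\<forall>e\<ge>snd p. e \<notin> A \<inter> test Z (k0 + k) (set (fst p)))"
    for Z k0 k and p :: "nat list list \<times> nat" and A
  have "determined {A. \<not> C Z k0 k p A}" for Z k0 k p
    unfolding determined_def
  proof
    fix A assume "A \<in> {A. \<not> C Z k0 k p A}"
    then consider "\<not> ((\<forall>w\<in>set (fst p). k0 + k \<le> length w) \<and> set (fst p) \<inter> nbhd Z k0 = {})"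
      | e where "snd p \<le> e" "e \<in> A" "e \<in> test Z (k0 + k) (set (fst p))"
      by (auto simp: C_def)
    then show "\<exists>n. \<forall>B. B \<inter> {..<n} = A \<inter> {..<n} \<longrightarrow> B \<in> {A. \<not> C Z k0 k p A}"
    proof cases
      case 1
      then show ?thesis by (auto simp: C_def)
    next
      case 2
      then show ?thesis by (intro exI[of _ "Suc e"]) (auto simp: C_def)
    qed
  qed
  then have "Sig 0 {A. \<not> C Z k0 k p A}" for Z k0 k p
    unfolding openin_powerset_topology_nat[symmetric] by (rule Sigma0_1plus.intros(1))
  then have "Sig (Suc (Suc (Suc (Suc (Suc 0)))))
      {A. \<exists>zs. \<forall>ys. \<exists>k0. \<forall>k. \<exists>p. C (set (zs @ ys)) k0 k p A}"
    by (intro Sig_Ex Sig_not_All)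
  moreover have "tree_ideal = {A. \<exists>zs. \<forall>ys. \<exists>k0. \<forall>k. \<exists>p. C (set (zs @ ys)) k0 k p A}"
  proof -
    have "A \<in> tree_ideal \<longleftrightarrow> (\<exists>zs. \<forall>ys. small (set (zs @ ys)) A)" for A
      by (simp only: tree_ideal_iff tree_ideal_from_def mem_Collect_eq ex_finite_iff_list
          all_finite_supset_iff_list)
    then show ?thesis unfolding C_def small_iff_list[symmetric] by blast
  qed
  ultimately show ?thesis by (simp add: numeral_eq_Suc)
qed

section \<open>Sets of additive class at most three as countable unions of G-delta sets\<close>

lemma fin_ord_0_least: "\<not> b < fin_ord 0"
  using below_fin_ord[of 0] by blast

lemma Sig_0_iff: "Sig 0 S \<longleftrightarrow> determined S"
  unfolding openin_powerset_topology_nat[symmetric]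
proof
  show "openin (powerset_topology UNIV) S" if "Sig 0 S"
    using that by cases (use fin_ord_0_least in auto)
qed (rule Sigma0_1plus.intros(1))

text \<open>The \<open>i\<close>-th closed set collects those \<open>A\<close> whose part below
  \<open>i\<close> already forces membership. This brings open sets into the normal form of the
  higher classes.\<close>

lemma determined_eq_UN_closed:
  assumes "determined S"
  shows "\<exists>Q :: nat \<Rightarrow> nat set set. (\<forall>i. determined (Q i)) \<and> S = (\<Union>i. UNIV - Q i)"
proof -
  define Q where "Q i = {A. \<not> (\<forall>B. B \<inter> {..<i} = A \<inter> {..<i} \<longrightarrow> B \<in> S)}" for i :: nat
  have "determined (Q i)" for i
    unfolding determined_def
  proof (intro ballI exI[of _ i] allI impI)
    fix A B assume "A \<in> Q i" "B \<inter> {..<i} = A \<inter> {..<i}"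
    then show "B \<in> Q i" by (simp add: Q_def)
  qed
  moreover have "S = (\<Union>i. UNIV - Q i)"
  proof (intro equalityI subsetI)
    fix A assume "A \<in> S"
    then obtain i where "\<forall>B. B \<inter> {..<i} = A \<inter> {..<i} \<longrightarrow> B \<in> S"
      using assms unfolding determined_def by blast
    then show "A \<in> (\<Union>i. UNIV - Q i)" by (auto simp: Q_def)
  qed (auto simp: Q_def)
  ultimately show ?thesis by blast
qed

lemma Sig_le_1:
  assumes "Sigma0_1plus (powerset_topology (UNIV :: nat set)) \<alpha> S" "\<alpha> < fin_ord 2"
  shows "\<exists>Q :: nat \<Rightarrow> nat set set. (\<forall>i. determined (Q i)) \<and> S = (\<Union>i. UNIV - Q i)"
  using assms(1)
proof cases
  case 1
  then show ?thesis
    by (intro determined_eq_UN_closed) (simp add: openin_powerset_topology_nat)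
next
  case (2 \<beta> B)
  have "\<beta> i \<in> fin_ord ` {..<1}" for i
  proof -
    have "\<alpha> \<in> fin_ord ` {..<2}" using assms(2) unfolding below_fin_ord[symmetric] by simp
    then have "\<alpha> \<le> fin_ord 1"
      using fin_ord_less_Suc[of 0] by (auto simp: less_2_cases_iff simp del: fin_ord.simps)
    then have "\<beta> i \<in> {b. b < fin_ord 1}" using 2(2) order.strict_trans2 by blast
    then show ?thesis unfolding below_fin_ord .
  qed
  then have "\<beta> i = fin_ord 0" for i by (auto simp del: fin_ord.simps)
  then have "determined (B i)" for i
    using 2(3)[of i] Sig_0_iff by metis
  then show ?thesis using 2(1) by auto
qed

text \<open>Bounding the rank from below means excluding every class up to index 2, so all of them
  are brought into one form.\<close>

lemma Sig_le_2:
  assumes "Sigma0_1plus (powerset_topology (UNIV :: nat set)) \<alpha> S" "\<alpha> \<le> fin_ord 2"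
  shows "\<exists>Q :: nat \<Rightarrow> nat \<Rightarrow> nat set set. (\<forall>n i. determined (Q n i)) \<and> S = (\<Union>n. \<Inter>i. Q n i)"
proof -
  have "\<exists>B :: nat \<Rightarrow> nat set set. (\<forall>n. \<exists>Q :: nat \<Rightarrow> nat set set.
      (\<forall>i. determined (Q i)) \<and> B n = (\<Union>i. UNIV - Q i)) \<and> S = (\<Union>n. UNIV - B n)"
    using assms(1)
  proof cases
    case 1
    then have "determined S" by (simp add: openin_powerset_topology_nat)
    from determined_eq_UN_closed[OF this]
    obtain B :: "nat \<Rightarrow> nat set set" where B: "\<And>i. determined (B i)" "S = (\<Union>i. UNIV - B i)"
      by blast
    show ?thesis
      by (rule exI[of _ B]) (use B(2) determined_eq_UN_closed[OF B(1)] in simp)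
  next
    case (2 \<beta> B)
    have "\<beta> n < fin_ord 2" for n
      using 2(2)[of n] assms(2) by (rule order.strict_trans2)
    then have "\<exists>Q :: nat \<Rightarrow> nat set set. (\<forall>i. determined (Q i)) \<and> B n = (\<Union>i. UNIV - Q i)" for n
      by (rule Sig_le_1[OF 2(3)])
    then show ?thesis using 2(1) by (intro exI[of _ B]) simp
  qed
  then obtain B and Q :: "nat \<Rightarrow> nat \<Rightarrow> nat set set" where
    "\<And>n i. determined (Q n i)" "\<And>n. B n = (\<Union>i. UNIV - Q n i)" "S = (\<Union>n. UNIV - B n)"
    by metis
  then show ?thesis by (intro exI[of _ Q]) auto
qed


section \<open>The rank is greater than two\<close>

text \<open>Unlike in a neighbourhood of all prefixes, large children are added at \<open>s\<close>
  only. This makes the fan of a child lie inside the fan of \<open>s\<close>, as in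
  \<open>fan_snoc_subset\<close>.\<close>

definition fan :: "nat list \<Rightarrow> nat \<Rightarrow> nat list set" where
  "fan s k = {p. prefix p s} \<union> {s @ j # t | j t. k \<le> j}"

text \<open>Codes of sets that meet the fan but contain no prefix of \<open>s\<close> stay
  undecided; passing to a child of \<open>s\<close> decides more of them.\<close>

definition obeys :: "nat list \<Rightarrow> nat \<Rightarrow> nat set \<Rightarrow> nat \<Rightarrow> bool" where
  "obeys s k A e \<longleftrightarrow> (nodes e \<inter> {p. prefix p s} \<noteq> {} \<longrightarrow> e \<notin> A) \<and>
     (nodes e \<inter> fan s k = {} \<longrightarrow> e \<in> A)"

text \<open>A triple \<open>(s, m, A)\<close> acts as a forcing condition: \<open>A\<close> decides
  the codes below \<open>m\<close>, and \<open>allowed\<close> collects the sets that keep the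
  promise of \<open>s\<close> from \<open>m\<close> on. The present requirement extends half of that
  promise to the decided part.\<close>

definition avoids_upto :: "nat list \<Rightarrow> nat \<Rightarrow> nat set \<Rightarrow> bool" where
  "avoids_upto s m A \<longleftrightarrow> (\<forall>e\<in>A \<inter> {..<m}. nodes e \<inter> {p. prefix p s} = {})"

definition allowed :: "nat list \<Rightarrow> nat \<Rightarrow> nat set \<Rightarrow> nat set set" where
  "allowed s m A = {B. B \<inter> {..<m} = A \<inter> {..<m} \<and> (\<forall>e\<ge>m. obeys s 0 B e)}"

lemma obeys_cong: "(e \<in> A \<longleftrightarrow> e \<in> B) \<Longrightarrow> obeys s k A e \<longleftrightarrow> obeys s k B e"
  by (simp add: obeys_def)

lemma fan_subset_nbhd: "fan s k \<subseteq> nbhd {p. prefix p s} k"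
  unfolding fan_def nbhd_def by blast

lemma fan_snoc_subset: "k \<le> j \<Longrightarrow> fan (s @ [j]) 0 \<subseteq> fan s k"
  by (auto simp: fan_def)

lemma obeys_snoc: "obeys (s @ [j]) 0 A e \<Longrightarrow> k \<le> j \<Longrightarrow> obeys s k A e"
  unfolding obeys_def using fan_snoc_subset[of k j s] by (auto simp: prefix_def)

lemma obeys_mono: "obeys s k A e \<Longrightarrow> l \<le> k \<Longrightarrow> obeys s l A e"
  unfolding obeys_def fan_def by fastforce

text \<open>The fan contains the prefixes of \<open>s\<close>, so the two halves of
  \<open>obeys\<close> never conflict.\<close>

lemma allowed_nonempty: "\<exists>B. B \<in> allowed s m A"
proof -
  have "{p. prefix p s} \<subseteq> fan s 0" by (auto simp: fan_def)
  then show ?thesis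
    by (intro exI[of _ "A \<inter> {..<m} \<union> {e. m \<le> e \<and> nodes e \<inter> fan s 0 = {}}"])
      (auto simp: allowed_def obeys_def)
qed

lemma agree_below: "A \<inter> {..<m} = B \<inter> {..<m} \<Longrightarrow> n \<le> m \<Longrightarrow> A \<inter> {..<n} = B \<inter> {..<n}"
  for m n :: nat
  by (metis Int_absorb1 Int_assoc lessThan_subset_iff)

lemma coherent_limit:
  fixes m :: "nat \<Rightarrow> nat" and A :: "nat \<Rightarrow> nat set"
  assumes mono: "\<And>t. m t < m (Suc t)"
    and coh: "\<And>t. A (Suc t) \<inter> {..<m t} = A t \<inter> {..<m t}"
  obtains B where "\<And>t. B \<inter> {..<m t} = A t \<inter> {..<m t}"
proof -
  have lim: "A u \<inter> {..<m t} = A t \<inter> {..<m t}" if "t \<le> u" for t u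
    using that
  proof (induction u rule: dec_induct)
    case (step u)
    have "m t \<le> m u" using step(1) mono by (simp add: lift_Suc_mono_le less_imp_le)
    then have "A (Suc u) \<inter> {..<m t} = A u \<inter> {..<m t}"
      by (rule agree_below[OF coh])
    then show ?case using step by simp
  qed simp
  have "(\<Union>u. A u \<inter> {..<m u}) \<inter> {..<m t} = A t \<inter> {..<m t}" for t
  proof -
    have "e \<in> A t" if "e \<in> A u" "e < m u" "e < m t" for e u
      using lim[of t u] lim[of u t] that by (metis IntD1 IntI lessThan_iff nat_le_linear)
    then show ?thesis by auto
  qed
  then show ?thesis using that by blast
qed

lemma strict_mono_interval:
  fixes m :: "nat \<Rightarrow> nat"
  assumes "\<And>t. m t < m (Suc t)" "m t \<le> e"
  obtains u where "t \<le> u" "m u \<le> e" "e < m (Suc u)"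
proof -
  have sm: "strict_mono m" using assms(1) by (simp add: strict_mono_Suc_iff)
  define u where "u = (LEAST v. e < m v)"
  have "e < m (Suc e)" using strict_mono_imp_increasing[OF sm, of "Suc e"] by simp
  then have u: "e < m u" unfolding u_def by (rule LeastI)
  have t: "t < u"
    using u assms(2) strict_mono_less_eq[OF sm, of u t] by (meson leI le_less_trans not_le)
  then obtain v where v: "u = Suc v" by (cases u) auto
  have "\<not> e < m v" using not_less_Least[of v "\<lambda>v. e < m v"] v by (simp add: u_def)
  then show ?thesis using that[of v] u t v by simp
qed

text \<open>Either some finite condition one level further down the tree already leaves the
  \<open>G\<^sub>\<delta>\<close> set \<open>\<Inter>i. Q i\<close>, or infinitely many failed attempts to reach such a condition assemble
  to a member of it whose complement is sparse around the prefixes of \<open>s\<close>.\<close>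

lemma leave_G_delta:
  assumes det: "\<And>i :: nat. determined (Q i)"
    and dual: "\<And>C. C \<in> tree_ideal \<Longrightarrow> \<exists>i. - C \<notin> Q i"
    and start: "avoids_upto s m A"
  shows "\<exists>j m' A'. m < m' \<and> avoids_upto (s @ [j]) m' A' \<and> allowed (s @ [j]) m' A' \<subseteq> allowed s m A \<and>
    (\<forall>B\<in>allowed (s @ [j]) m' A'. \<exists>i. B \<notin> Q i)"
proof (rule ccontr)
  assume "\<not> ?thesis"
  then have fail: "\<exists>B\<in>allowed (s @ [j]) m' A'. \<forall>i. B \<in> Q i"
    if "m < m'" "avoids_upto (s @ [j]) m' A'" "allowed (s @ [j]) m' A' \<subseteq> allowed s m A" for j m' A'
    using that by blast
  define valid where "valid p \<longleftrightarrow> m < fst p \<and> snd p \<inter> {..<m} = A \<inter> {..<m} \<and> avoids_upto s (fst p) (snd p) \<and>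
    (\<forall>e. m \<le> e \<and> e < fst p \<longrightarrow> obeys s 0 (snd p) e)" for p
  define succ where "succ t p q \<longleftrightarrow> fst p < fst q \<and> snd q \<inter> {..<fst p} = snd p \<inter> {..<fst p} \<and>
    (\<forall>e. fst p \<le> e \<and> e < fst q \<longrightarrow> obeys s t (snd q) e) \<and>
    (\<forall>B. B \<inter> {..<fst q} = snd q \<inter> {..<fst q} \<longrightarrow> B \<in> Q t)" for t p q
  have step: "\<exists>q. valid q \<and> succ t p q" if "valid p" for t p
  proof -
    obtain m' A' where p: "p = (m', A')" by (cases p)
    note valid = that[unfolded valid_def p fst_conv snd_conv]
    have "finite (\<Union>e<m'. \<Union>w\<in>nodes e. set w)" by (simp add: finite_nodes)
    then obtain j0 where j0: "\<And>i. i \<in> (\<Union>e<m'. \<Union>w\<in>nodes e. set w) \<Longrightarrow> i < j0"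
      by (metis finite_nat_set_iff_bounded)
    \<comment> \<open>\<open>j0\<close> keeps the new node out of all sets coded below
      \<open>m'\<close>, so the decided part suits \<open>s @ [j]\<close>; being at least
      \<open>t\<close> makes attempt \<open>t\<close> obey \<open>s\<close> with bound
      \<open>t\<close>.\<close>
    define j where "j = max t j0"
    have new: "s @ [j] \<notin> nodes e" if "e < m'" for e
      using j0[of j] that unfolding j_def by (metis UN_I in_set_conv_decomp lessThan_iff max.cobounded2 not_le)
    have "avoids_upto (s @ [j]) m' A'"
      using valid new unfolding avoids_upto_def by auto
    moreover have sub: "allowed (s @ [j]) m' A' \<subseteq> allowed s m A"
    proof
      fix B assume B: "B \<in> allowed (s @ [j]) m' A'"
      then have eq: "e \<in> B \<longleftrightarrow> e \<in> A'" if "e < m'" for e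
        using that by (auto simp: allowed_def)
      have "obeys s 0 B e" if "m \<le> e" for e
      proof (cases "e < m'")
        case True
        then show ?thesis using valid that eq obeys_cong by blast
      next
        case False
        then have "obeys (s @ [j]) 0 B e" using B by (simp add: allowed_def)
        then show ?thesis by (rule obeys_snoc) simp
      qed
      moreover have "B \<inter> {..<m} = A \<inter> {..<m}"
        using eq valid by (auto simp: set_eq_iff)
      ultimately show "B \<in> allowed s m A" by (simp add: allowed_def)
    qed
    ultimately obtain B where B: "B \<in> allowed (s @ [j]) m' A'" "B \<in> Q t"
      using fail valid by blast
    \<comment> \<open>Openness of \<open>Q t\<close> lets a finite part of \<open>B\<close> secure
      membership in it for the limit.\<close>
    obtain n where n: "\<And>C. C \<inter> {..<n} = B \<inter> {..<n} \<Longrightarrow> C \<in> Q t"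
      using det[of t] B(2) unfolding determined_def by blast
    define m'' where "m'' = max n (Suc m')"
    have ob: "obeys s t B e" if "m' \<le> e" for e
      using B(1) that by (intro obeys_snoc[of s j]) (auto simp: allowed_def j_def)
    have eq: "B \<inter> {..<m'} = A' \<inter> {..<m'}" using B(1) by (simp add: allowed_def)
    have "avoids_upto s m'' B"
      unfolding avoids_upto_def
    proof
      fix e assume e: "e \<in> B \<inter> {..<m''}"
      show "nodes e \<inter> {p. prefix p s} = {}"
      proof (cases "e < m'")
        case True
        then have "e \<in> A'" using e eq by blast
        then show ?thesis using valid True by (auto simp: avoids_upto_def)
      next
        case False
        then show ?thesis using ob[of e] e by (auto simp: obeys_def)
      qed
    qed
    moreover have "C \<in> Q t" if "C \<inter> {..<m''} = B \<inter> {..<m''}" for C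
      using agree_below[OF that, of n] by (intro n) (simp add: m''_def)
    moreover have "B \<inter> {..<m} = A \<inter> {..<m}" "\<forall>e\<ge>m. obeys s 0 B e"
      using B(1) sub by (auto simp: allowed_def)
    moreover have "m < m''" "m' < m''" using valid by (simp_all add: m''_def less_Suc_eq max_def)
    ultimately have "valid (m'', B) \<and> succ t p (m'', B)"
      using eq ob unfolding valid_def succ_def p by simp
    then show ?thesis by blast
  qed
  have "\<exists>p. valid p"
  proof -
    obtain B where B: "B \<in> allowed s m A" using allowed_nonempty by blast
    then have B_m: "B \<inter> {..<m} = A \<inter> {..<m}" and ob: "\<forall>e\<ge>m. obeys s 0 B e"
      by (auto simp: allowed_def)
    have "nodes e \<inter> {p. prefix p s} = {}" if "e \<in> B" "e < Suc m" for e
    proof (cases "e < m")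
      case True
      then have "e \<in> A \<inter> {..<m}" using B_m that by blast
      then show ?thesis using start by (simp add: avoids_upto_def)
    next
      case False
      then show ?thesis using ob[rule_format, of e] that(1) by (simp add: obeys_def)
    qed
    \<comment> \<open>The length is \<open>Suc m\<close> because \<open>fail\<close> applies only to
      lengths above \<open>m\<close>.\<close>
    then have "valid (Suc m, B)"
      using B_m ob unfolding valid_def avoids_upto_def by simp
    then show ?thesis by blast
  qed
  then obtain p where p: "\<And>t. valid (p t)" "\<And>t. succ t (p t) (p (Suc t))"
    using dependent_nat_choice[of "\<lambda>_. valid" succ] step by metis
  define M B where "M t = fst (p t)" and "B t = snd (p t)" for t
  have M: "M t < M (Suc t)" and coh: "B (Suc t) \<inter> {..<M t} = B t \<inter> {..<M t}"
    and ob: "M t \<le> e \<Longrightarrow> e < M (Suc t) \<Longrightarrow> obeys s t (B (Suc t)) e"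
    and Q: "F \<inter> {..<M (Suc t)} = B (Suc t) \<inter> {..<M (Suc t)} \<Longrightarrow> F \<in> Q t" for t e F
    using p(2)[of t] unfolding succ_def M_def B_def by auto
  obtain F where F: "\<And>t. F \<inter> {..<M t} = B t \<inter> {..<M t}"
    using coherent_limit[of M B] M coh by metis
  \<comment> \<open>From \<open>M k\<close> on, every segment obeys \<open>s\<close> with a bound at
    least \<open>k\<close>, so \<open>F\<close> contains each later code of a set missing the
    neighbourhood with index \<open>k\<close>.\<close>
  have "- F \<in> tree_ideal"
  proof (rule sparse_in_tree_ideal)
    show "finite {p. prefix p s}"
      by (metis List.finite_set set_prefixes_eq)
    fix k
    have "{e \<in> - F. nodes e \<inter> nbhd {p. prefix p s} k = {}} \<subseteq> {..<M k}"
    proof (rule ccontr)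
      assume "\<not> {e \<in> - F. nodes e \<inter> nbhd {p. prefix p s} k = {}} \<subseteq> {..<M k}"
      then obtain e where "e \<in> - F" "nodes e \<inter> nbhd {p. prefix p s} k = {}" "e \<notin> {..<M k}"
        by blast
      then have e: "e \<notin> F" "nodes e \<inter> nbhd {p. prefix p s} k = {}" "M k \<le> e"
        by simp_all
      obtain t where t: "k \<le> t" "M t \<le> e" "e < M (Suc t)"
        using strict_mono_interval[of M k e] M e(3) by metis
      have "e \<in> B (Suc t)"
        using obeys_mono[OF ob[OF t(2,3)] t(1)] e(2) fan_subset_nbhd[of s k]
        unfolding obeys_def by blast
      then show False using F[of "Suc t"] t(3) e(1) by blast
    qed
    then show "finite {e \<in> - F. nodes e \<inter> nbhd {p. prefix p s} k = {}}"
      using finite_subset by blast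
  qed
  then show False
    using dual Q[OF F] by fastforce
qed

lemma tree_ideal_not_separated:
  fixes Q :: "nat \<Rightarrow> nat \<Rightarrow> nat set set"
  assumes det: "\<And>n i. determined (Q n i)"
    and S: "S = (\<Union>n. \<Inter>i. Q n i)"
  shows "\<not> separates S tree_ideal (dual_filter UNIV tree_ideal)"
proof
  assume sep: "separates S tree_ideal (dual_filter UNIV tree_ideal)"
  have dual: "\<exists>i. - C \<notin> Q n i" if "C \<in> tree_ideal" for C n
  proof -
    have "- C \<in> dual_filter UNIV tree_ideal"
      using that unfolding dual_filter_def by (auto simp: Compl_eq_Diff_UNIV)
    then show ?thesis using sep S unfolding separates_def by blast
  qed
  define valid where "valid p \<longleftrightarrow> (case p of (s, m, A) \<Rightarrow> avoids_upto s m A)" for p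
  define succ where "succ n p q \<longleftrightarrow> (case p of (s, m, A) \<Rightarrow> case q of (s', m', A') \<Rightarrow>
    m < m' \<and> (\<exists>j. s' = s @ [j]) \<and> allowed s' m' A' \<subseteq> allowed s m A \<and>
    (\<forall>B\<in>allowed s' m' A'. \<exists>i. B \<notin> Q n i))" for n p q
  have "valid ([], 0, {})" by (simp add: valid_def avoids_upto_def)
  moreover have "\<exists>q. valid q \<and> succ n p q" if "valid p" for n p
  proof -
    obtain s m A where p: "p = (s, m, A)" by (cases p)
    have "avoids_upto s m A" using that by (simp add: valid_def p)
    from leave_G_delta[of "Q n", OF det dual this] obtain j m' A' where
      "m < m'" "avoids_upto (s @ [j]) m' A'" "allowed (s @ [j]) m' A' \<subseteq> allowed s m A"
      "\<forall>B\<in>allowed (s @ [j]) m' A'. \<exists>i. B \<notin> Q n i"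
      by blast
    then have "valid (s @ [j], m', A') \<and> succ n p (s @ [j], m', A')"
      by (auto simp: valid_def succ_def p)
    then show ?thesis by blast
  qed
  ultimately obtain p where p: "\<And>n. valid (p n)" "\<And>n. succ n (p n) (p (Suc n))"
    "p 0 = ([], 0, {})"
    using dependent_nat_choice[of "\<lambda>n p. valid p \<and> (n = 0 \<longrightarrow> p = ([], 0, {}))" succ] by blast
  define s m A where "s n = fst (p n)" and "m n = fst (snd (p n))" and "A n = snd (snd (p n))" for n
  have avoid: "avoids_upto (s n) (m n) (A n)" and m: "m n < m (Suc n)"
    and s: "\<exists>j. s (Suc n) = s n @ [j]"
    and sub: "allowed (s (Suc n)) (m (Suc n)) (A (Suc n)) \<subseteq> allowed (s n) (m n) (A n)"
    and out: "B \<in> allowed (s (Suc n)) (m (Suc n)) (A (Suc n)) \<Longrightarrow> \<exists>i. B \<notin> Q n i" for n B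
    using p(1)[of n] p(2)[of n]
    unfolding valid_def succ_def s_def m_def A_def by (auto simp: case_prod_unfold)
  have coh: "A (Suc n) \<inter> {..<m n} = A n \<inter> {..<m n}" for n
  proof -
    obtain B where "B \<in> allowed (s (Suc n)) (m (Suc n)) (A (Suc n))"
      using allowed_nonempty by blast
    with sub[of n] have "B \<inter> {..<m (Suc n)} = A (Suc n) \<inter> {..<m (Suc n)}" "B \<inter> {..<m n} = A n \<inter> {..<m n}"
      by (auto simp: allowed_def)
    then show ?thesis using m[of n] agree_below by (metis less_imp_le)
  qed
  obtain F where F: "\<And>n. F \<inter> {..<m n} = A n \<inter> {..<m n}"
    using coherent_limit[of m A] m coh by metis
  have sub': "allowed (s v) (m v) (A v) \<subseteq> allowed (s n) (m n) (A n)" if "n \<le> v" for n v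
    using that by (induction v rule: dec_induct) (use sub in blast)+
  \<comment> \<open>At each code, \<open>F\<close> agrees with a set allowed by some later
    condition, and \<open>obeys\<close> looks at one code at a time.\<close>
  have F_allowed: "F \<in> allowed (s n) (m n) (A n)" for n
    unfolding allowed_def
  proof (intro CollectI conjI allI impI F)
    fix e assume "m n \<le> e"
    then obtain u where u: "n \<le> u" "m u \<le> e" "e < m (Suc u)"
      using strict_mono_interval[of m n e] m by metis
    obtain B where B: "B \<in> allowed (s (Suc u)) (m (Suc u)) (A (Suc u))"
      using allowed_nonempty by blast
    then have "B \<inter> {..<m (Suc u)} = F \<inter> {..<m (Suc u)}" using F by (simp add: allowed_def)
    then have "e \<in> B \<longleftrightarrow> e \<in> F" using u(3) by blast
    moreover have "obeys (s n) 0 B e"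
      using B sub'[of n "Suc u"] u(1) \<open>m n \<le> e\<close> by (auto simp: allowed_def)
    ultimately show "obeys (s n) 0 F e" using obeys_cong by blast
  qed
  have len: "length (s n) = n" for n
    by (induction n) (use s p(3) in \<open>auto simp: s_def\<close>, metis length_append_singleton)
  define x where "x n = last (s (Suc n))" for n
  have sx: "s n = map x [0..<n]" for n
  proof (induction n)
    case 0
    then show ?case using len[of 0] by simp
  next
    case (Suc n)
    then show ?case using s[of n] by (auto simp: x_def)
  qed
  have "F \<in> tree_ideal"
  proof (rule branch_avoiding_in_tree_ideal)
    fix e n assume e: "e \<in> F"
    have "nodes e \<inter> {p. prefix p (s n)} = {}"
    proof (cases "e < m n")
      case True
      then show ?thesis using e F[of n] avoid[of n] by (auto simp: avoids_upto_def)
    next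
      case False
      then have "obeys (s n) 0 F e" using F_allowed by (simp add: allowed_def)
      then show ?thesis using e by (auto simp: obeys_def)
    qed
    then show "map x [0..<n] \<notin> nodes e" by (auto simp: sx)
  qed
  then have "F \<in> (\<Union>n. \<Inter>i. Q n i)"
    using sep unfolding separates_def S[symmetric] by blast
  then obtain n where "\<forall>i. F \<in> Q n i" by auto
  then show False using out[OF F_allowed[of "Suc n"]] by simp
qed

text \<open>The least index is meaningful only if some class separates. The ideal itself does so,
  being of class index 5 and disjoint from its dual filter.\<close>

lemma ideal_rank_tree_ideal: "fin_ord 2 < ideal_rank UNIV tree_ideal"
proof -
  define P where "P \<alpha> \<longleftrightarrow> (\<exists>S. Sigma0_1plus (powerset_topology UNIV) \<alpha> S \<and>
    separates S tree_ideal (dual_filter UNIV tree_ideal))" for \<alpha>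
  have "separates tree_ideal tree_ideal (dual_filter UNIV tree_ideal)"
  proof -
    have False if "UNIV - A \<in> tree_ideal" "A \<in> tree_ideal" for A
    proof -
      have "(UNIV - A) \<union> A \<in> tree_ideal" and "tree_ideal \<noteq> Pow UNIV"
        using that ideal_on_tree_ideal unfolding ideal_on_def by blast+
      moreover have "(UNIV - A) \<union> A = UNIV" by blast
      ultimately show False
        using ideal_on_tree_ideal unfolding ideal_on_def by (metis Pow_UNIV UNIV_eq_I subset_UNIV)
    qed
    then show ?thesis by (auto simp: separates_def dual_filter_def)
  qed
  then have "P (fin_ord 5)" using Sig_tree_ideal unfolding P_def by blast
  then have "P (LEAST \<alpha>. P \<alpha>)" by (rule LeastI)
  moreover have "\<not> P \<alpha>" if "\<alpha> \<le> fin_ord 2" for \<alpha>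
    using Sig_le_2[OF _ that] tree_ideal_not_separated unfolding P_def by metis
  ultimately show ?thesis
    unfolding ideal_rank_def P_def[symmetric] by (meson not_le)
qed


section \<open>There is no copy of Fin3\<close>

lemma Union_Fin: "\<Union>Fin = UNIV"
  unfolding Fin_def by (auto intro!: exI[of _ "{_}"])

lemma Union_ideal_prod:
  assumes "\<Union>I = UNIV" "\<Union>J = UNIV" "{} \<in> I" "{} \<in> J"
    and I: "\<And>A B. A \<in> I \<Longrightarrow> B \<subseteq> A \<Longrightarrow> B \<in> I"
  shows "\<Union>(I \<otimes>\<^sub>I J) = UNIV"
proof -
  have "p \<in> \<Union>(I \<otimes>\<^sub>I J)" for p
  proof -
    have "fst p \<in> \<Union>I" unfolding assms(1) by simp
    then obtain B where B: "fst p \<in> B" "B \<in> I" by blast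
    have "{x. {y. (x, y) = p} \<notin> J} \<subseteq> B"
    proof
      fix x assume "x \<in> {x. {y. (x, y) = p} \<notin> J}"
      then have "{y. (x, y) = p} \<noteq> {}" using assms(4) by (metis mem_Collect_eq)
      then show "x \<in> B" using B(1) by auto
    qed
    then have "{x. {y. (x, y) = p} \<notin> J} \<in> I" using I B(2) by blast
    then have "{p} \<in> I \<otimes>\<^sub>I J"
      by (simp add: ideal_prod_def assms(1,2))
    then show ?thesis by blast
  qed
  then show ?thesis by blast
qed

lemma mem_Fin2: "A \<in> Fin \<otimes>\<^sub>I Fin \<longleftrightarrow> finite {x. infinite {y. (x, y) \<in> A}}"
  unfolding ideal_prod_def Union_Fin by (simp add: Fin_def)

lemma Union_Fin2: "\<Union>(Fin \<otimes>\<^sub>I Fin) = UNIV"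
  by (rule Union_ideal_prod) (auto simp: Union_Fin, auto simp: Fin_def intro: finite_subset)

lemma mem_Fin3: "A \<in> Fin3 \<longleftrightarrow> finite {i. infinite {j. infinite {k. (i, j, k) \<in> A}}}"
  unfolding Fin3_def ideal_prod_def[of Fin "Fin \<otimes>\<^sub>I Fin"] Union_Fin Union_Fin2 mem_Fin2
  by (simp add: Fin_def)

lemma Union_Fin3: "\<Union>Fin3 = UNIV"
  unfolding Fin3_def
  by (rule Union_ideal_prod) (auto simp: Union_Fin Union_Fin2 mem_Fin2, auto simp: Fin_def intro: finite_subset)

text \<open>Here \<open>a\<close> and \<open>b\<close> are the first two coordinates of the
  bijection, and the three clauses are preimages of sets that generate \<open>Fin3\<close>.\<close>

lemma contains_copy_of_Fin3D:
  fixes J :: "nat set set"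
  assumes "\<Union>J = UNIV" "contains_copy_of J Fin3"
  shows "\<exists>(a :: nat \<Rightarrow> nat) (b :: nat \<Rightarrow> nat). (\<forall>i. {e. a e < i} \<in> J) \<and> (\<forall>z. {e. b e \<le> z (a e)} \<in> J) \<and>
    (\<forall>D. (\<forall>i j. finite {e\<in>D. a e = i \<and> b e = j}) \<longrightarrow> D \<in> J)"
proof -
  obtain f where f: "bij_betw f (UNIV :: nat set) (UNIV :: (nat \<times> nat \<times> nat) set)"
    and copy: "\<And>A. A \<in> Fin3 \<Longrightarrow> f -` A \<in> J"
    using assms(2) unfolding contains_copy_of_def assms(1) Union_Fin3 by auto
  define a b where "a e = fst (f e)" and "b e = fst (snd (f e))" for e
  have "{e. a e < i} \<in> J" for i
  proof -
    have "{(i', j, k). i' < i} \<in> Fin3" by (simp add: mem_Fin3)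
    from copy[OF this] show ?thesis by (simp add: a_def vimage_def case_prod_unfold)
  qed
  moreover have "{e. b e \<le> z (a e)} \<in> J" for z
  proof -
    have "{(i, j, k). j \<le> z i} \<in> Fin3" by (simp add: mem_Fin3)
    from copy[OF this] show ?thesis by (simp add: a_def b_def vimage_def case_prod_unfold)
  qed
  moreover have "D \<in> J" if D: "\<And>i j. finite {e\<in>D. a e = i \<and> b e = j}" for D
  proof -
    have "finite {k. (i, j, k) \<in> f ` D}" for i j
    proof -
      have "{k. (i, j, k) \<in> f ` D} \<subseteq> (\<lambda>e. snd (snd (f e))) ` {e\<in>D. a e = i \<and> b e = j}"
      proof
        fix k assume "k \<in> {k. (i, j, k) \<in> f ` D}"
        then obtain e where "e \<in> D" "f e = (i, j, k)" by auto
        then show "k \<in> (\<lambda>e. snd (snd (f e))) ` {e\<in>D. a e = i \<and> b e = j}"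
          by (intro image_eqI[of _ _ e]) (auto simp: a_def b_def)
      qed
      then show ?thesis using D finite_subset by blast
    qed
    then have "f ` D \<in> Fin3" by (simp add: mem_Fin3)
    from copy[OF this] show ?thesis
      using f by (simp add: bij_betw_def inj_vimage_image_eq)
  qed
  ultimately have "(\<forall>i. {e. a e < i} \<in> J) \<and> (\<forall>z. {e. b e \<le> z (a e)} \<in> J) \<and>
    (\<forall>D. (\<forall>i j. finite {e\<in>D. a e = i \<and> b e = j}) \<longrightarrow> D \<in> J)"
    by blast
  then show ?thesis by (intro exI)
qed

lemma not_contains_copy_tree_ideal: "\<not> contains_copy_of tree_ideal Fin3"
proof
  assume copy: "contains_copy_of tree_ideal Fin3"
  have cover: "\<Union>tree_ideal = UNIV"
  proof -
    have "{e} \<in> tree_ideal" for e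
      using ideal_on_tree_ideal unfolding ideal_on_def by simp
    then show ?thesis by blast
  qed
  obtain a b :: "nat \<Rightarrow> nat" where
    below: "\<And>i. {e. a e < i} \<in> tree_ideal" and
    graph: "\<And>z. {e. b e \<le> z (a e)} \<in> tree_ideal" and
    thin: "\<And>D. (\<And>i j. finite {e\<in>D. a e = i \<and> b e = j}) \<Longrightarrow> D \<in> tree_ideal"
    using contains_copy_of_Fin3D[OF cover copy] by auto
  define box where "box l = {e. a e < l \<and> b e < l}" for l
  have box_mono: "l \<le> l' \<Longrightarrow> box l \<subseteq> box l'" for l l'
    by (auto simp: box_def)
  have fin_box: "\<exists>l. F \<subseteq> box l" if "finite F" for F
  proof -
    have "finite (a ` F \<union> b ` F)" using that by simp
    then obtain l where "\<forall>n\<in>a ` F \<union> b ` F. n < l" by (metis finite_nat_set_iff_bounded)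
    then show ?thesis by (auto simp: box_def)
  qed

  text \<open>The witness \<open>Z\<close> can be chosen uniformly in \<open>z\<close>: otherwise a function dominating
    counterexamples for the countably many candidates yields a contradiction.\<close>
  have "\<exists>Z m. finite Z \<and> (\<forall>z. {e. m \<le> a e \<and> b e \<le> z (a e)} \<in> tree_ideal_from Z)"
  proof (rule ccontr)
    assume neg: "\<not> ?thesis"
    \<comment> \<open>The index \<open>c\<close> is both the code of the candidate set and the
      cutoff for \<open>a e\<close>, so at \<open>i\<close> only the finitely many
      \<open>y c\<close> with \<open>c \<le> i\<close> have to be dominated.\<close>
    have "\<exists>z. {e. c \<le> a e \<and> b e \<le> z (a e)} \<notin> tree_ideal_from (set (from_nat c))" for c
    proof (rule ccontr)
      assume all: "\<not> ?thesis"
      show False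
        by (rule neg[THEN notE], intro exI[of _ "set (from_nat c)"] exI[of _ c] conjI List.finite_set)
          (rule all[unfolded not_ex not_not])
    qed
    then obtain y where y: "\<And>c. {e. c \<le> a e \<and> b e \<le> y c (a e)} \<notin> tree_ideal_from (set (from_nat c))"
      by metis
    define z where "z i = Max ((\<lambda>c. y c i) ` {..i})" for i
    obtain Z where Z: "finite Z" "{e. b e \<le> z (a e)} \<in> tree_ideal_from Z"
      using graph[of z] tree_ideal_iff by blast
    obtain zs where "set zs = Z" using Z(1) finite_list by blast
    then obtain c where c: "Z = set (from_nat c)" by (metis from_nat_to_nat)
    have "y c i \<le> z i" if "c \<le> i" for i
      unfolding z_def using that by (intro Max_ge) auto
    then have "{e. c \<le> a e \<and> b e \<le> y c (a e)} \<subseteq> {e. b e \<le> z (a e)}"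
      using order.trans by blast
    then show False using tree_ideal_from_subset[OF Z(2)] y c by blast
  qed
  then obtain Z1 m where Z1: "finite Z1" "\<And>z. {e. m \<le> a e \<and> b e \<le> z (a e)} \<in> tree_ideal_from Z1"
    by blast

  \<comment> \<open>Such a \<open>D\<close> is thin, hence in the ideal, and turns finiteness of a
    trace on a test set into inclusion of the whole test set in a box.\<close>
  have "\<exists>D. (\<forall>l. finite (D \<inter> box l)) \<and>
    (\<forall>Z k W. finite Z \<longrightarrow> finite W \<longrightarrow> finite (D \<inter> test Z k W) \<longrightarrow> (\<exists>l. test Z k W \<subseteq> box l))"
  proof -
    \<comment> \<open>Every test set is listed for arbitrarily large \<open>n\<close>, so an
      unbounded one receives points outside arbitrarily large boxes.\<close>
    define R where "R n = (case from_nat (fst (prod_decode n)) of (zs, k, ws) \<Rightarrow>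
      test (set zs) k (set ws))" for n
    define pick where "pick n = (SOME e. e \<in> R n - box n)" for n
    define D where "D = pick ` {n. R n - box n \<noteq> {}}"
    have pick: "pick n \<in> R n - box n" if "R n - box n \<noteq> {}" for n
      unfolding pick_def using that by (metis ex_in_conv someI_ex)
    have "finite (D \<inter> box l)" for l
    proof -
      have "D \<inter> box l \<subseteq> pick ` {..<l}"
      proof
        fix e assume e: "e \<in> D \<inter> box l"
        then obtain n where n: "e = pick n" "R n - box n \<noteq> {}" by (auto simp: D_def)
        then have "\<not> l \<le> n" using pick[OF n(2)] e box_mono[of l n] by blast
        then show "e \<in> pick ` {..<l}" using n(1) by simp
      qed
      then show ?thesis using finite_subset by blast
    qed
    moreover have "\<exists>l. test Z k W \<subseteq> box l" if fin: "finite Z" "finite W" "finite (D \<inter> test Z k W)" for Z k W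
    proof (rule ccontr)
      assume nb: "\<not> ?thesis"
      obtain l where l: "D \<inter> test Z k W \<subseteq> box l" using fin_box fin(3) by blast
      obtain zs ws where zw: "set zs = Z" "set ws = W" using fin(1,2) finite_list by metis
      define n where "n = prod_encode (to_nat (zs, k, ws), l)"
      have R: "R n = test Z k W" by (simp add: R_def n_def zw)
      have n: "l \<le> n" unfolding n_def by (rule le_prod_encode_2)
      have ne: "R n - box n \<noteq> {}" using nb R by blast
      then have "pick n \<in> D \<inter> test Z k W"
        using pick[OF ne] R by (auto simp: D_def)
      then have "pick n \<in> box n" using l box_mono[OF n] by blast
      then show False using pick[OF ne] by blast
    qed
    ultimately show ?thesis by blast
  qed
  then obtain D where D: "\<And>l. finite (D \<inter> box l)"
    "\<And>Z k W. finite Z \<Longrightarrow> finite W \<Longrightarrow> finite (D \<inter> test Z k W) \<Longrightarrow> \<exists>l. test Z k W \<subseteq> box l"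
    by blast
  have "D \<in> tree_ideal"
  proof (rule thin)
    fix i j
    have "{e\<in>D. a e = i \<and> b e = j} \<subseteq> D \<inter> box (Suc (max i j))" by (auto simp: box_def)
    then show "finite {e\<in>D. a e = i \<and> b e = j}" using D(1) finite_subset by blast
  qed
  then obtain Z2 where Z2: "finite Z2" "D \<in> tree_ideal_from Z2"
    using tree_ideal_iff by blast
  define Z where "Z = Z1 \<union> Z2"
  have Z: "finite Z" "Z1 \<subseteq> Z" "Z2 \<subseteq> Z" using Z1 Z2 by (auto simp: Z_def)
  obtain k0 where "\<exists>W. finite W \<and> (\<forall>w\<in>W. k \<le> length w) \<and> W \<inter> nbhd Z k0 = {} \<and> finite (D \<inter> test Z k W)"
    if "k0 \<le> k" for k
    using smallD[of Z D] Z2(2) Z unfolding tree_ideal_from_def by blast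
  then have "\<exists>W l. finite W \<and> (\<forall>w\<in>W. k \<le> length w) \<and> W \<inter> nbhd Z k0 = {} \<and> test Z k W \<subseteq> box l"
    if "k0 \<le> k" for k
    using D(2)[OF Z(1)] that by meson
  then obtain W l where W: "k0 \<le> k \<Longrightarrow> finite (W k)" "\<And>w. k0 \<le> k \<Longrightarrow> w \<in> W k \<Longrightarrow> k \<le> length w"
    "k0 \<le> k \<Longrightarrow> W k \<inter> nbhd Z k0 = {}" and l: "k0 \<le> k \<Longrightarrow> test Z k (W k) \<subseteq> box (l k)" for k
    by metis

  have "\<exists>Y k1. finite Y \<and> Z \<subseteq> Y \<and> (\<forall>k\<ge>k1. \<exists>T. finite T \<and> T \<inter> nbhd Y k1 = {} \<and>
    finite ({e. a e < i} \<inter> test Y k T))" for i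
  proof -
    obtain Y where Y: "finite Y" "{e. a e < i} \<in> tree_ideal_from Y"
      using below[of i] tree_ideal_iff by blast
    then have "small (Y \<union> Z) {e. a e < i}"
      using Z(1) unfolding tree_ideal_from_def by blast
    then show ?thesis
      using Y(1) Z(1) by (elim smallD) (intro exI[of _ "Y \<union> Z"], auto, meson)
  qed
  then obtain Y k1 where Y: "\<And>i. finite (Y i)" "\<And>i. Z \<subseteq> Y i" and
    k1: "\<And>i k. k1 i \<le> k \<Longrightarrow> \<exists>T. finite T \<and> T \<inter> nbhd (Y i) (k1 i) = {} \<and>
      finite ({e. a e < i} \<inter> test (Y i) k T)"
    by metis
  \<comment> \<open>The level exceeds the lengths of all nodes in \<open>Y i\<close>, so witnesses
    at this level are disjoint from \<open>Y i\<close>. It is fixed before \<open>z\<close>, which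
    depends on it.\<close>
  have "\<exists>k. i \<le> k \<and> k0 \<le> k \<and> k1 i \<le> k \<and> (\<forall>s\<in>Y i. length s < k)" for i
  proof -
    have "finite (length ` Y i)" using Y(1) by simp
    then obtain k where "\<forall>n\<in>length ` Y i. n < k" by (metis finite_nat_set_iff_bounded)
    then show ?thesis
      by (intro exI[of _ "max (max i k0) (max (k1 i) k)"]) (auto simp: less_max_iff_disj)
  qed
  then obtain \<kappa> where \<kappa>: "\<And>i. i \<le> \<kappa> i" "\<And>i. k0 \<le> \<kappa> i" "\<And>i. k1 i \<le> \<kappa> i"
    "\<And>i s. s \<in> Y i \<Longrightarrow> length s < \<kappa> i"
    by metis
  define z where "z i = Max ((\<lambda>i. l (\<kappa> i)) ` {..i})" for i
  have z: "l (\<kappa> i) \<le> z i'" if "i \<le> i'" for i i'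
    unfolding z_def using that by (intro Max_ge) auto
  define E where "E = {e. m \<le> a e \<and> b e \<le> z (a e)}"
  have "small Z E"
    using Z1(2)[of z] Z unfolding tree_ideal_from_def E_def by blast
  then obtain k2 where k2: "\<And>k. k2 \<le> k \<Longrightarrow> \<exists>H. finite H \<and> (\<forall>h\<in>H. k \<le> length h) \<and>
     H \<inter> nbhd Z k2 = {} \<and> finite (E \<inter> test Z k H)"
    by (rule smallD) blast

  define i where "i = max m k2"
  define k where "k = \<kappa> i"
  have k: "k0 \<le> k" "k1 i \<le> k" "k2 \<le> k" "m \<le> i" "\<And>s. s \<in> Y i \<Longrightarrow> length s < k"
    using \<kappa>(1-3)[of i] \<kappa>(4)[of _ i] unfolding k_def i_def by auto
  obtain H where H: "finite H" "\<And>h. h \<in> H \<Longrightarrow> k \<le> length h" "H \<inter> nbhd Z k2 = {}" "finite (E \<inter> test Z k H)"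
    using k2[OF k(3)] by blast
  \<comment> \<open>\<open>W k\<close> and \<open>H\<close> may still meet
    \<open>nbhd (Y i) (k1 i)\<close>; disjointness from \<open>Y i\<close> allows raising the index
    until they do not.\<close>
  have "(W k \<union> H) \<inter> Y i = {}"
    using H(2) W(2)[OF k(1)] k(5) by (fastforce simp: not_le[symmetric])
  moreover have "finite (W k \<union> H)" using H(1) W(1)[OF k(1)] by simp
  ultimately obtain k3 where k3: "\<And>k'. k3 \<le> k' \<Longrightarrow> (W k \<union> H) \<inter> nbhd (Y i) k' = {}"
    using finite_avoids_nbhd by metis
  define k' where "k' = max k3 (k1 i)"
  \<comment> \<open>\<open>T\<close> is taken at the raised index \<open>k'\<close> but avoids the
    neighbourhood with the fixed index \<open>k1 i\<close>. As \<open>k1 i \<le> k\<close>, it also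
    avoids \<open>nbhd Z k\<close>.\<close>
  obtain T where T: "finite T" "T \<inter> nbhd (Y i) (k1 i) = {}" "finite ({e. a e < i} \<inter> test (Y i) k' T)"
    using k1[of i k'] by (auto simp: k'_def)
  define F where "F = W k \<union> H \<union> T"
  have F_Z: "F \<inter> nbhd Z k = {}"
  proof -
    have "nbhd Z k \<subseteq> nbhd Z k0" "nbhd Z k \<subseteq> nbhd Z k2" "nbhd Z k \<subseteq> nbhd (Y i) (k1 i)"
      by (rule nbhd_mono; use k Y(2) in simp)+
    then show ?thesis using W(3)[OF k(1)] H(3) T(2) unfolding F_def by blast
  qed
  have F_Y: "F \<inter> nbhd (Y i) k' = {}"
  proof -
    have "nbhd (Y i) k' \<subseteq> nbhd (Y i) (k1 i)" by (simp add: nbhd_mono k'_def)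
    then show ?thesis using k3[of k'] T(2) unfolding F_def by (auto simp: k'_def)
  qed
  \<comment> \<open>A code of \<open>F\<close> with \<open>a e \<ge> i\<close> lies in
    \<open>box (l k)\<close>, so \<open>b e\<close> is below \<open>z (a e)\<close> and the code is
    in \<open>E\<close>. Infinitely many codes are thus covered by two finite sets.\<close>
  have "{e. nodes e = F} \<subseteq> ({e. a e < i} \<inter> test (Y i) k' T) \<union> (E \<inter> test Z k H)"
  proof
    fix e assume "e \<in> {e. nodes e = F}"
    then have e: "e \<in> test (Y i) k' T" "e \<in> test Z k H" "e \<in> test Z k (W k)"
      using F_Y F_Z by (auto simp: test_def F_def)
    have "e \<in> E" if "i \<le> a e"
    proof -
      have "b e < l k" using l[OF k(1)] e(3) by (auto simp: box_def)
      also have "l k \<le> z (a e)" unfolding k_def by (rule z[OF that])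
      finally show ?thesis using that k(4) by (simp add: E_def)
    qed
    then show "e \<in> ({e. a e < i} \<inter> test (Y i) k' T) \<union> (E \<inter> test Z k H)"
      using e by fastforce
  qed
  moreover have "finite F" using T(1) H(1) W(1)[OF k(1)] by (simp add: F_def)
  ultimately show False
    using infinite_nodes_eq T(3) H(4) finite_subset by blast
qed

theorem theorem2p5:
  shows "\<exists>(X :: nat set) I.
    ideal_on X I \<and>
    Sigma0_1plus (powerset_topology X) (fin_ord 5) I \<and>
    fin_ord 2 < ideal_rank X I \<and>
    \<not> contains_copy_of I Fin3"
  using ideal_on_tree_ideal Sig_tree_ideal ideal_rank_tree_ideal not_contains_copy_tree_ideal by blast

end
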